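(* Let $F$ be a field and let $n,u$ be positive integers such that $x^n-u$ is irreducible over $\mathbb{Q}$. Let $g\in F(x_0,\dots,x_{n-1})\setminus F$. Then $g,g^*,\dots,g^{(n-1)*}$ are algebraically independent over $F$.
   Context: Let $(\ )^*:F(x_0,\dots,x_{n-1})\to F(x_0,\dots,x_{n-1})$ be the $F$-algebra monomorphism with $x_i^*=x_{i+1}$ for $0\le i<n-1$ and $x_{n-1}^*=x_0^u$; $g^{i*}$ denotes the $i$-fold application of $(\ )^*$ to $g$. *)

theory Defs
  imports
    "HOL-Library.Poly_Mapping"
    "HOL-Computational_Algebra.Computational_Algebra"
begin

text \<open>
  A polynomial in the variables $x_0, x_1, \dots$ is a finitely supported map from exponent
  vectors to coefficients. The ring in $n$ variables and its fraction field are the parts of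
  these types that only involve the variables with index below $n$.
\<close>

type_synonym 'a mpoly = "(nat \<Rightarrow>\<^sub>0 nat) \<Rightarrow>\<^sub>0 'a"

type_synonym 'a ratfun = "'a mpoly fract"

definition vars :: "'a::zero mpoly \<Rightarrow> nat set" where
  "vars p = (\<Union>m\<in>Poly_Mapping.keys p. Poly_Mapping.keys m)"

definition mpoly_const :: "'a::zero \<Rightarrow> 'a mpoly" where
  "mpoly_const c = Poly_Mapping.single 0 c"

definition mpoly_var :: "nat \<Rightarrow> 'a::zero_neq_one mpoly" where
  "mpoly_var i = Poly_Mapping.single (Poly_Mapping.single i 1) 1"

definition monom_eval :: "(nat \<Rightarrow> 'b) \<Rightarrow> (nat \<Rightarrow>\<^sub>0 nat) \<Rightarrow> 'b::comm_ring_1" where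
  "monom_eval x m = (\<Prod>i\<in>Poly_Mapping.keys m. x i ^ Poly_Mapping.lookup m i)"

definition mpoly_eval :: "('a::zero \<Rightarrow> 'b) \<Rightarrow> (nat \<Rightarrow> 'b) \<Rightarrow> 'a mpoly \<Rightarrow> 'b::comm_ring_1" where
  "mpoly_eval h x p = (\<Sum>m\<in>Poly_Mapping.keys p. h (Poly_Mapping.lookup p m) * monom_eval x m)"

definition ratfun_const :: "'a::field \<Rightarrow> 'a ratfun" where
  "ratfun_const c = Fract (mpoly_const c) 1"

definition ratfun_var :: "nat \<Rightarrow> 'a::field ratfun" where
  "ratfun_var i = Fract (mpoly_var i) 1"

definition ratfuns :: "nat \<Rightarrow> 'a::field ratfun set" where
  "ratfuns n = {Fract p q | p q. q \<noteq> 0 \<and> vars p \<subseteq> {..<n} \<and> vars q \<subseteq> {..<n}}"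

definition alg_independent :: "nat \<Rightarrow> (nat \<Rightarrow> 'a::field ratfun) \<Rightarrow> bool" where
  "alg_independent k f \<longleftrightarrow>
     (\<forall>P :: 'a mpoly. vars P \<subseteq> {..<k} \<longrightarrow> mpoly_eval ratfun_const f P = 0 \<longrightarrow> P = 0)"

text \<open>
  The variables with index at least $n$ play no role; they are fixed, so that the substitution is
  injective on all polynomials.
\<close>

definition star_var :: "nat \<Rightarrow> nat \<Rightarrow> nat \<Rightarrow> 'a::field mpoly" where
  "star_var n u i =
     (if i + 1 < n then mpoly_var (i + 1) else if i + 1 = n then mpoly_var 0 ^ u else mpoly_var i)"

definition mpoly_star :: "nat \<Rightarrow> nat \<Rightarrow> 'a::field mpoly \<Rightarrow> 'a mpoly" where
  "mpoly_star n u p = mpoly_eval mpoly_const (star_var n u) p"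

text \<open>
  For positive \<open>u\<close> the value does not depend on the representation of the fraction; see
  \<open>star_Fract\<close> below. The lemmas at the end of this theory show that \<open>star n u\<close> restricts to an
  \<open>F\<close>-algebra monomorphism of the rational function field in $n$ variables with the prescribed
  values on the variables, and that it is the only such homomorphism.
\<close>

definition star :: "nat \<Rightarrow> nat \<Rightarrow> 'a::field ratfun \<Rightarrow> 'a ratfun" where
  "star n u g =
     (THE r. \<exists>p q. q \<noteq> 0 \<and> g = Fract p q \<and> r = Fract (mpoly_star n u p) (mpoly_star n u q))"

subsection \<open>Evaluation of polynomials\<close>

lemma monom_eval_superset:
  assumes "finite A" "Poly_Mapping.keys m \<subseteq> A"
  shows "monom_eval x m = (\<Prod>i\<in>A. x i ^ Poly_Mapping.lookup m i)"
  unfolding monom_eval_def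
  by (rule prod.mono_neutral_left) (use assms in \<open>auto simp: in_keys_iff\<close>)

lemma monom_eval_zero [simp]: "monom_eval x 0 = 1"
  by (simp add: monom_eval_def)

lemma monom_eval_single [simp]: "monom_eval x (Poly_Mapping.single i k) = x i ^ k"
  by (simp add: monom_eval_def)

lemma monom_eval_add: "monom_eval x (m + m') = monom_eval x m * monom_eval x m'"
proof -
  let ?A = "Poly_Mapping.keys m \<union> Poly_Mapping.keys m'"
  have "monom_eval x (m + m') = (\<Prod>i\<in>?A. x i ^ Poly_Mapping.lookup (m + m') i)"
    by (rule monom_eval_superset) (auto simp: keys_add)
  also have "\<dots> = (\<Prod>i\<in>?A. x i ^ Poly_Mapping.lookup m i) * (\<Prod>i\<in>?A. x i ^ Poly_Mapping.lookup m' i)"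
    by (simp add: lookup_add power_add prod.distrib)
  also have "\<dots> = monom_eval x m * monom_eval x m'"
    by (simp add: monom_eval_superset[of ?A])
  finally show ?thesis .
qed

lemma mpoly_sum_singles:
  "p = (\<Sum>m\<in>Poly_Mapping.keys p. Poly_Mapping.single m (Poly_Mapping.lookup p m))"
  by (rule poly_mapping_eqI)
    (auto simp: lookup_sum lookup_single when_def sum.delta in_keys_iff)

locale coeff_hom =
  fixes h :: "'a::comm_ring_1 \<Rightarrow> 'b::comm_ring_1"
  assumes h_zero: "h 0 = 0" and h_one: "h 1 = 1"
    and h_add: "h (a + b) = h a + h b" and h_mult: "h (a * b) = h a * h b"
begin

lemma eval_zero [simp]: "mpoly_eval h x 0 = 0"
  by (simp add: mpoly_eval_def)

lemma eval_single: "mpoly_eval h x (Poly_Mapping.single m c) = h c * monom_eval x m"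
  by (simp add: mpoly_eval_def h_zero)

lemma eval_one [simp]: "mpoly_eval h x 1 = 1"
  using eval_single[of x 0 1] by (simp add: h_one)

lemma eval_const: "mpoly_eval h x (mpoly_const c) = h c"
  by (simp add: mpoly_const_def eval_single)

lemma eval_var: "mpoly_eval h x (mpoly_var i) = x i"
  by (simp add: mpoly_var_def eval_single h_one)

lemma eval_add: "mpoly_eval h x (p + q) = mpoly_eval h x p + mpoly_eval h x q"
  unfolding mpoly_eval_def
  by (rule setsum_keys_plus_distrib) (auto simp: h_zero h_add algebra_simps)

lemma eval_sum: "mpoly_eval h x (sum f A) = (\<Sum>a\<in>A. mpoly_eval h x (f a))"
  by (induction A rule: infinite_finite_induct) (auto simp: eval_add)

lemma eval_mult: "mpoly_eval h x (p * q) = mpoly_eval h x p * mpoly_eval h x q"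
proof -
  have "p * q = (\<Sum>m\<in>Poly_Mapping.keys p. \<Sum>m'\<in>Poly_Mapping.keys q.
      Poly_Mapping.single m (Poly_Mapping.lookup p m) * Poly_Mapping.single m' (Poly_Mapping.lookup q m'))"
    by (subst mpoly_sum_singles[of p], subst mpoly_sum_singles[of q]) (rule sum_product)
  then have "mpoly_eval h x (p * q) = (\<Sum>m\<in>Poly_Mapping.keys p. \<Sum>m'\<in>Poly_Mapping.keys q.
      (h (Poly_Mapping.lookup p m) * monom_eval x m) * (h (Poly_Mapping.lookup q m') * monom_eval x m'))"
    by (simp add: eval_sum mult_single eval_single h_mult monom_eval_add mult_ac)
  also have "\<dots> = mpoly_eval h x p * mpoly_eval h x q"
    unfolding mpoly_eval_def by (rule sum_product[symmetric])
  finally show ?thesis .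
qed

end

interpretation mpoly_const: coeff_hom "mpoly_const :: 'a::field \<Rightarrow> 'a mpoly"
  by unfold_locales (auto simp: mpoly_const_def single_add mult_single)

interpretation ratfun_const: coeff_hom "ratfun_const :: 'a::field \<Rightarrow> 'a ratfun"
  by unfold_locales
    (auto simp: ratfun_const_def mpoly_const.h_zero mpoly_const.h_one mpoly_const.h_add
      mpoly_const.h_mult fract_collapse)

subsection \<open>The map \<open>star\<close> is a monomorphism\<close>

definition star_exp :: "nat \<Rightarrow> nat \<Rightarrow> nat \<Rightarrow> nat \<Rightarrow>\<^sub>0 nat" where
  "star_exp n u i = (if i + 1 < n then Poly_Mapping.single (i + 1) 1
     else if i + 1 = n then Poly_Mapping.single 0 u else Poly_Mapping.single i 1)"

definition star_monom :: "nat \<Rightarrow> nat \<Rightarrow> (nat \<Rightarrow>\<^sub>0 nat) \<Rightarrow> (nat \<Rightarrow>\<^sub>0 nat)" where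
  "star_monom n u m = (\<Sum>i\<in>Poly_Mapping.keys m. of_nat (Poly_Mapping.lookup m i) * star_exp n u i)"

lemma single_power:
  "(Poly_Mapping.single e (1::'a::field) :: 'a mpoly) ^ k = Poly_Mapping.single (of_nat k * e) 1"
  by (induction k) (auto simp: mult_single algebra_simps)

lemma star_var_eq: "star_var n u i = Poly_Mapping.single (star_exp n u i) (1 :: 'a::field)"
  by (auto simp: star_var_def star_exp_def mpoly_var_def single_power mult_single
      simp flip: single_of_nat)

lemma prod_single:
  "finite A \<Longrightarrow> (\<Prod>i\<in>A. (Poly_Mapping.single (e i) (1::'a::field) :: 'a mpoly)) =
    Poly_Mapping.single (\<Sum>i\<in>A. e i) 1"
  by (induction A rule: finite_induct) (auto simp: mult_single)

lemma monom_eval_star_var: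
  "monom_eval (star_var n u) m = Poly_Mapping.single (star_monom n u m) (1 :: 'a::field)"
  by (simp add: monom_eval_def star_var_eq single_power prod_single star_monom_def)

lemma lookup_of_nat_mult: "Poly_Mapping.lookup (of_nat k * (e :: nat \<Rightarrow>\<^sub>0 nat)) i = k * Poly_Mapping.lookup e i"
  by (induction k) (auto simp: lookup_add algebra_simps)

lemma lookup_star_monom:
  assumes "i + 1 < n"
  shows "Poly_Mapping.lookup (star_monom n u m) (i + 1) = Poly_Mapping.lookup m i"
proof -
  have "Poly_Mapping.lookup (star_monom n u m) (i + 1) = (\<Sum>j\<in>Poly_Mapping.keys m. if j = i then Poly_Mapping.lookup m j else 0)"
    unfolding star_monom_def lookup_sum lookup_of_nat_mult
    using assms by (intro sum.cong) (auto simp: star_exp_def lookup_single when_def)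
  then show ?thesis by (simp add: in_keys_iff)
qed

lemma lookup_star_monom_0:
  assumes "n > 0"
  shows "Poly_Mapping.lookup (star_monom n u m) 0 = u * Poly_Mapping.lookup m (n - 1)"
proof -
  have "Poly_Mapping.lookup (star_monom n u m) 0 = (\<Sum>j\<in>Poly_Mapping.keys m. if j = n - 1 then u * Poly_Mapping.lookup m j else 0)"
    unfolding star_monom_def lookup_sum lookup_of_nat_mult
    using assms by (intro sum.cong) (auto simp: star_exp_def lookup_single when_def)
  then show ?thesis by (simp add: in_keys_iff)
qed

lemma lookup_star_monom_ge:
  assumes "i \<ge> n"
  shows "Poly_Mapping.lookup (star_monom n u m) i = Poly_Mapping.lookup m i"
proof -
  have "Poly_Mapping.lookup (star_monom n u m) i = (\<Sum>j\<in>Poly_Mapping.keys m. if j = i then Poly_Mapping.lookup m j else 0)"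
    unfolding star_monom_def lookup_sum lookup_of_nat_mult
    using assms by (intro sum.cong) (auto simp: star_exp_def lookup_single when_def)
  then show ?thesis by (simp add: in_keys_iff)
qed

lemma inj_star_monom:
  assumes "u > 0"
  shows "inj (star_monom n u)"
proof (rule injI, rule poly_mapping_eqI)
  fix m m' i assume eq: "star_monom n u m = star_monom n u m'"
  consider "i + 1 < n" | "i + 1 = n" | "i \<ge> n" by linarith
  then show "Poly_Mapping.lookup m i = Poly_Mapping.lookup m' i"
  proof cases
    case 1
    then show ?thesis using lookup_star_monom[OF 1] eq by metis
  next
    case 2
    then have "u * Poly_Mapping.lookup m i = u * Poly_Mapping.lookup m' i"
      using lookup_star_monom_0[of n u] eq by (metis add_diff_cancel_right' add_gr_0 zero_less_one)
    then show ?thesis using assms by simp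
  next
    case 3
    then show ?thesis using lookup_star_monom_ge[OF 3] eq by metis
  qed
qed

lemma mpoly_star_eq:
  "mpoly_star n u p = (\<Sum>m\<in>Poly_Mapping.keys p. Poly_Mapping.single (star_monom n u m) (Poly_Mapping.lookup p m))"
  by (simp add: mpoly_star_def mpoly_eval_def monom_eval_star_var mpoly_const_def mult_single)

lemma lookup_mpoly_star:
  assumes "u > 0"
  shows "Poly_Mapping.lookup (mpoly_star n u p) (star_monom n u m) = Poly_Mapping.lookup p m"
proof -
  have "Poly_Mapping.lookup (mpoly_star n u p) (star_monom n u m) =
      (\<Sum>k\<in>Poly_Mapping.keys p. if k = m then Poly_Mapping.lookup p k else 0)"
    unfolding mpoly_star_eq lookup_sum lookup_single
    using inj_star_monom[OF assms, of n]
    by (intro sum.cong) (auto simp: when_def inj_def)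
  then show ?thesis by (simp add: in_keys_iff)
qed

lemma mpoly_star_add: "mpoly_star n u (p + q) = mpoly_star n u p + mpoly_star n u q"
  by (simp add: mpoly_star_def mpoly_const.eval_add)

lemma mpoly_star_mult: "mpoly_star n u (p * q) = mpoly_star n u p * mpoly_star n u q"
  by (simp add: mpoly_star_def mpoly_const.eval_mult)

lemma mpoly_star_zero [simp]: "mpoly_star n u 0 = 0"
  by (simp add: mpoly_star_def)

lemma mpoly_star_one [simp]: "mpoly_star n u 1 = 1"
  by (simp add: mpoly_star_def)

lemma inj_mpoly_star:
  assumes "u > 0"
  shows "inj (mpoly_star n u :: 'a::field mpoly \<Rightarrow> 'a mpoly)"
  by (rule injI, rule poly_mapping_eqI) (metis lookup_mpoly_star[OF assms])

lemma mpoly_star_eq_0_iff: "u > 0 \<Longrightarrow> mpoly_star n u p = 0 \<longleftrightarrow> p = 0"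
  using inj_mpoly_star[of u n] mpoly_star_zero[of n u] by (metis injD)

lemma star_Fract:
  assumes "u > 0" "q \<noteq> 0"
  shows "star n u (Fract p q) = Fract (mpoly_star n u p) (mpoly_star n u q)"
  unfolding star_def
proof (rule the_equality)
  fix r assume "\<exists>p' q'. q' \<noteq> 0 \<and> Fract p q = Fract p' q' \<and>
    r = Fract (mpoly_star n u p') (mpoly_star n u q')"
  then obtain p' q' where *: "q' \<noteq> 0" "Fract p q = Fract p' q'"
    "r = Fract (mpoly_star n u p') (mpoly_star n u q')" by blast
  then have "p * q' = p' * q" using assms by (simp add: eq_fract)
  then have "mpoly_star n u p * mpoly_star n u q' = mpoly_star n u p' * mpoly_star n u q"
    by (metis mpoly_star_mult)
  then show "r = Fract (mpoly_star n u p) (mpoly_star n u q)"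
    using * assms by (simp add: eq_fract mpoly_star_eq_0_iff)
qed (use assms in blast)

lemma star_const: "u > 0 \<Longrightarrow> star n u (ratfun_const c) = ratfun_const c"
  by (simp add: ratfun_const_def star_Fract) (simp add: mpoly_star_def mpoly_const.eval_const)

lemma star_add: "u > 0 \<Longrightarrow> star n u (f + g) = star n u f + star n u g"
  by (cases f; cases g) (simp add: star_Fract mpoly_star_eq_0_iff mpoly_star_add mpoly_star_mult)

lemma star_mult: "u > 0 \<Longrightarrow> star n u (f * g) = star n u f * star n u g"
  by (cases f; cases g) (simp add: star_Fract mpoly_star_eq_0_iff mpoly_star_mult)

lemma inj_star:
  assumes "u > 0"
  shows "inj (star n u :: 'a::field ratfun \<Rightarrow> 'a ratfun)"
proof (rule injI)
  fix f g :: "'a ratfun" assume eq: "star n u f = star n u g"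
  obtain a b where f: "f = Fract a b" "b \<noteq> 0" by (cases f) auto
  obtain c d where g: "g = Fract c d" "d \<noteq> 0" by (cases g) auto
  have "mpoly_star n u a * mpoly_star n u d = mpoly_star n u c * mpoly_star n u b"
    using eq f g assms by (simp add: star_Fract eq_fract mpoly_star_eq_0_iff)
  then have "a * d = c * b"
    using inj_mpoly_star[OF assms, of n] by (metis mpoly_star_mult injD)
  then show "f = g" using f g by (simp add: eq_fract)
qed

lemma ratfun_var_power: "ratfun_var i ^ k = Fract (mpoly_var i ^ k) 1"
  by (induction k) (auto simp: ratfun_var_def One_fract_def)

lemma star_ratfun_var:
  assumes "u > 0" "i < n"
  shows "star n u (ratfun_var i) =
    (if i < n - 1 then ratfun_var (i + 1) else ratfun_var 0 ^ u)"
proof -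
  have "star n u (ratfun_var i) = Fract (star_var n u i) 1"
    using assms by (simp add: ratfun_var_def star_Fract) (simp add: mpoly_star_def mpoly_const.eval_var)
  then show ?thesis
    using assms ratfun_var_power[of 0 u, where ?'a = 'a]
    by (auto simp: star_var_def ratfun_var_def less_diff_conv)
qed

lemma vars_mpoly_star:
  assumes "vars p \<subseteq> {..<n}"
  shows "vars (mpoly_star n u p) \<subseteq> {..<n}"
proof
  fix i assume "i \<in> vars (mpoly_star n u p)"
  then obtain k where k: "Poly_Mapping.lookup (mpoly_star n u p) k \<noteq> 0" "i \<in> Poly_Mapping.keys k"
    by (auto simp: vars_def in_keys_iff)
  from k(1) obtain m where m: "m \<in> Poly_Mapping.keys p" "star_monom n u m = k"
    unfolding mpoly_star_eq lookup_sum
    by (metis (mono_tags, lifting) sum.neutral lookup_single_not_eq)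
  show "i \<in> {..<n}"
  proof (rule ccontr)
    assume "i \<notin> {..<n}"
    then have "i \<ge> n" by simp
    then have "Poly_Mapping.lookup m i \<noteq> 0"
      using k(2) m(2) lookup_star_monom_ge[of n i u m] by (auto simp: in_keys_iff split: if_splits)
    then have "i \<in> vars p" using m(1) by (auto simp: vars_def in_keys_iff)
    then show False using assms \<open>i \<notin> {..<n}\<close> by blast
  qed
qed

lemma star_in_ratfuns:
  assumes "u > 0" "g \<in> ratfuns n"
  shows "star n u g \<in> ratfuns n"
proof -
  obtain p q where pq: "g = Fract p q" "q \<noteq> 0" "vars p \<subseteq> {..<n}" "vars q \<subseteq> {..<n}"
    using assms(2) unfolding ratfuns_def by blast
  then have "mpoly_star n u q \<noteq> 0"
    using assms(1) by (simp add: mpoly_star_eq_0_iff)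
  then show ?thesis
    unfolding pq(1) star_Fract[OF assms(1) pq(2)] ratfuns_def
    using vars_mpoly_star[OF pq(3)] vars_mpoly_star[OF pq(4)] by blast
qed

lemma vars_single: "vars (Poly_Mapping.single m c) \<subseteq> Poly_Mapping.keys m"
  by (auto simp: vars_def)

lemma vars_add: "vars (p + q) \<subseteq> vars p \<union> vars q"
  using keys_add[of p q] by (auto simp: vars_def)

lemma vars_sum: "vars (sum f A) \<subseteq> (\<Union>a\<in>A. vars (f a))"
proof (induction A rule: infinite_finite_induct)
  case (insert a A)
  then show ?case using vars_add[of "f a" "sum f A"] by auto
qed (auto simp: vars_def)

lemma Fract_in_ratfuns: "vars p \<subseteq> {..<n} \<Longrightarrow> Fract p 1 \<in> ratfuns n"
  unfolding ratfuns_def by (force simp: vars_def)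

lemma ratfuns_hom_eqI:
  fixes \<phi> \<psi> :: "'a::field ratfun \<Rightarrow> 'a ratfun"
  assumes add: "\<And>f g. f \<in> ratfuns n \<Longrightarrow> g \<in> ratfuns n \<Longrightarrow> \<phi> (f + g) = \<phi> f + \<phi> g"
    and mult: "\<And>f g. f \<in> ratfuns n \<Longrightarrow> g \<in> ratfuns n \<Longrightarrow> \<phi> (f * g) = \<phi> f * \<phi> g"
    and add': "\<And>f g. f \<in> ratfuns n \<Longrightarrow> g \<in> ratfuns n \<Longrightarrow> \<psi> (f + g) = \<psi> f + \<psi> g"
    and mult': "\<And>f g. f \<in> ratfuns n \<Longrightarrow> g \<in> ratfuns n \<Longrightarrow> \<psi> (f * g) = \<psi> f * \<psi> g"
    and const: "\<And>c. \<phi> (ratfun_const c) = \<psi> (ratfun_const c)"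
    and var: "\<And>i. i < n \<Longrightarrow> \<phi> (ratfun_var i) = \<psi> (ratfun_var i)"
    and nz: "\<And>f. f \<noteq> 0 \<Longrightarrow> \<psi> f \<noteq> 0"
    and g: "g \<in> ratfuns n"
  shows "\<phi> g = \<psi> g"
proof -
  define E where "E p \<longleftrightarrow> vars p \<subseteq> {..<n} \<and> \<phi> (Fract p 1) = \<psi> (Fract p 1)" for p :: "'a mpoly"
  have E_add: "E (p + q)" if "E p" "E q" for p q
  proof -
    have "Fract p 1 \<in> ratfuns n" "Fract q 1 \<in> ratfuns n"
      using that by (auto simp: E_def Fract_in_ratfuns)
    from add[OF this] add'[OF this] show ?thesis
      using that vars_add[of p q] by (auto simp: E_def)
  qed
  have E_mult: "E (p * q)" if "E p" "E q" "vars (p * q) \<subseteq> {..<n}" for p q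
  proof -
    have "Fract p 1 \<in> ratfuns n" "Fract q 1 \<in> ratfuns n"
      using that by (auto simp: E_def Fract_in_ratfuns)
    from mult[OF this] mult'[OF this] show ?thesis
      using that by (auto simp: E_def)
  qed
  have E_const: "E (Poly_Mapping.single 0 c)" for c
    using const[of c] by (auto simp: E_def ratfun_const_def mpoly_const_def vars_def)
  have E_pow: "E (Poly_Mapping.single (Poly_Mapping.single i k) 1)" if "i < n" for i k
  proof (induction k)
    case 0
    then show ?case using E_const[of 1] by simp
  next
    case (Suc k)
    have "E (mpoly_var i)"
      using var[OF that] that by (auto simp: E_def ratfun_var_def mpoly_var_def vars_def)
    moreover have eq: "mpoly_var i * Poly_Mapping.single (Poly_Mapping.single i k) (1::'a) =
        Poly_Mapping.single (Poly_Mapping.single i (Suc k)) 1"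
      by (simp add: mpoly_var_def mult_single flip: single_add)
    moreover have "vars (Poly_Mapping.single (Poly_Mapping.single i (Suc k)) (1::'a)) \<subseteq> {..<n}"
      using that by (auto simp: vars_def)
    ultimately show ?case using E_mult[OF _ Suc] by metis
  qed
  have E_monom: "E (Poly_Mapping.single (\<Sum>i\<in>B. Poly_Mapping.single i (k i)) 1)"
    if "finite B" "B \<subseteq> {..<n}" for B and k :: "nat \<Rightarrow> nat"
    using that
  proof (induction B rule: finite_induct)
    case empty
    then show ?case using E_const[of 1] by simp
  next
    case (insert i B)
    let ?s = "\<lambda>B. \<Sum>i\<in>B. Poly_Mapping.single i (k i)"
    have sub: "Poly_Mapping.keys (?s (insert i B)) \<subseteq> {..<n}"
    proof
      fix j assume "j \<in> Poly_Mapping.keys (?s (insert i B))"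
      then have "(\<Sum>a\<in>insert i B. Poly_Mapping.lookup (Poly_Mapping.single a (k a)) j) \<noteq> 0"
        by (simp only: in_keys_iff lookup_sum not_False_eq_True)
      then obtain a where "a \<in> insert i B" "Poly_Mapping.lookup (Poly_Mapping.single a (k a)) j \<noteq> 0"
        by (meson sum.not_neutral_contains_not_neutral)
      then show "j \<in> {..<n}"
        using insert.prems by (auto simp: lookup_single when_def split: if_splits)
    qed
    have eq: "Poly_Mapping.single (Poly_Mapping.single i (k i)) (1::'a) *
        Poly_Mapping.single (?s B) 1 = Poly_Mapping.single (?s (insert i B)) 1"
      using insert by (simp add: mult_single)
    have "vars (Poly_Mapping.single (?s (insert i B)) (1::'a)) \<subseteq> {..<n}"
      using sub vars_single by blast
    then show ?case
      using E_mult[OF E_pow[of i "k i"] insert.IH] insert.prems unfolding eq by auto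
  qed
  have E_term: "E (Poly_Mapping.single m c)" if "Poly_Mapping.keys m \<subseteq> {..<n}" for m c
  proof -
    have "E (Poly_Mapping.single m 1)"
      using E_monom[OF finite_keys that, of "Poly_Mapping.lookup m"]
      by (simp flip: mpoly_sum_singles)
    moreover have "Poly_Mapping.single 0 c * Poly_Mapping.single m 1 = Poly_Mapping.single m c"
      by (simp add: mult_single)
    moreover have "vars (Poly_Mapping.single m c) \<subseteq> {..<n}"
      using that vars_single by blast
    ultimately show ?thesis using E_mult[OF E_const[of c]] by metis
  qed
  have E_sum: "E (\<Sum>m\<in>A. Poly_Mapping.single m (c m))"
    if "finite A" "\<And>m. m \<in> A \<Longrightarrow> Poly_Mapping.keys m \<subseteq> {..<n}" for A and c
    using that
  proof (induction A rule: finite_induct)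
    case empty
    then show ?case using E_const[of 0] by simp
  next
    case (insert m A)
    then show ?case using E_add E_term by simp
  qed
  have E_all: "E p" if "vars p \<subseteq> {..<n}" for p
  proof -
    have "E (\<Sum>m\<in>Poly_Mapping.keys p. Poly_Mapping.single m (Poly_Mapping.lookup p m))"
      by (rule E_sum) (use that in \<open>auto simp: vars_def\<close>)
    then show ?thesis by (simp flip: mpoly_sum_singles)
  qed
  obtain p q where pq: "g = Fract p q" "q \<noteq> 0" "vars p \<subseteq> {..<n}" "vars q \<subseteq> {..<n}"
    using g by (auto simp: ratfuns_def)
  have q: "Fract q 1 \<in> ratfuns n" using pq by (simp add: Fract_in_ratfuns)
  have prod: "g * Fract q 1 = Fract p 1" using pq by (simp add: eq_fract)
  have "\<phi> g * \<psi> (Fract q 1) = \<psi> g * \<psi> (Fract q 1)"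
    using mult[OF g q] mult'[OF g q] E_all[OF pq(3)] E_all[OF pq(4)] prod by (simp add: E_def)
  moreover have "\<psi> (Fract q 1) \<noteq> 0"
    using pq by (intro nz) (simp add: Zero_fract_def eq_fract)
  ultimately show ?thesis by simp
qed

lemma star_unique:
  fixes \<phi> :: "'a::field ratfun \<Rightarrow> 'a ratfun"
  assumes "u > 0"
    and "\<And>f g. f \<in> ratfuns n \<Longrightarrow> g \<in> ratfuns n \<Longrightarrow> \<phi> (f + g) = \<phi> f + \<phi> g"
    and "\<And>f g. f \<in> ratfuns n \<Longrightarrow> g \<in> ratfuns n \<Longrightarrow> \<phi> (f * g) = \<phi> f * \<phi> g"
    and "\<And>c. \<phi> (ratfun_const c) = ratfun_const c"
    and "\<And>i. i < n - 1 \<Longrightarrow> \<phi> (ratfun_var i) = ratfun_var (i + 1)"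
    and "\<phi> (ratfun_var (n - 1)) = ratfun_var 0 ^ u"
    and "g \<in> ratfuns n"
  shows "\<phi> g = star n u g"
proof (rule ratfuns_hom_eqI[of n \<phi> "star n u"])
  fix i assume "i < n"
  then show "\<phi> (ratfun_var i) = star n u (ratfun_var i)"
    using assms(1,5,6) star_ratfun_var[of u i n, where ?'a = 'a]
    by (cases "i = n - 1") auto
next
  have "star n u (ratfun_const 0) = ratfun_const (0::'a)" using assms(1) by (rule star_const)
  then have "star n u (0 :: 'a ratfun) = 0" by (simp add: ratfun_const.h_zero)
  then show "star n u f \<noteq> 0" if "f \<noteq> 0" for f :: "'a ratfun"
    using inj_star[OF assms(1), of n] that by (metis injD)
qed (simp_all add: star_add star_mult star_const assms(1-4,7))

end

theory Submission
  imports Defs "HOL-Computational_Algebra.Field_as_Ring"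
begin

text \<open>
  Let $\theta = u^{1/n}$ and weigh the monomial $x^m$ by $\sum_{i<n} m_i \theta^i$. Irreducibility
  of $x^n - u$ makes $1, \theta, \dots, \theta^{n-1}$ linearly independent over the rationals, so
  distinct monomials have distinct weights, and the weight of the leading term extends to a
  degree on the rational function field with values in the reals and residue field $F$. The map
  \<open>star\<close> multiplies the degree by $\theta$. If $g$ has degree $r \neq 0$, then the monomials in
  $g, g^*, \dots, g^{(n-1)*}$ have pairwise distinct degrees, so no nontrivial linear combination
  of them vanishes. If $g$ has degree $0$, subtracting its residue, a constant, leads back to the
  first case.
\<close>

section \<open>Linear independence of the powers of a root\<close>

lemma map_poly_of_rat_add:
  "map_poly of_rat (p + q) = (map_poly of_rat p + map_poly of_rat q :: 'a::field_char_0 poly)"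
  by (rule poly_eqI) (simp add: coeff_map_poly of_rat_add)

lemma map_poly_of_rat_diff:
  "map_poly of_rat (p - q) = (map_poly of_rat p - map_poly of_rat q :: 'a::field_char_0 poly)"
  by (rule poly_eqI) (simp add: coeff_map_poly of_rat_diff)

lemma map_poly_of_rat_mult:
  "map_poly of_rat (p * q) = (map_poly of_rat p * map_poly of_rat q :: 'a::field_char_0 poly)"
  by (rule poly_eqI) (simp add: coeff_map_poly coeff_mult of_rat_sum of_rat_mult)

lemma map_poly_of_rat_sum:
  "map_poly of_rat (sum f A) = (\<Sum>i\<in>A. map_poly of_rat (f i) :: 'a::field_char_0 poly)"
  by (induction A rule: infinite_finite_induct) (simp_all add: map_poly_of_rat_add)

text \<open>A nonzero \<open>f\<close> of smaller degree is coprime to the irreducible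
  \<open>p\<close>; evaluating a Bezout identity at the common root \<open>t\<close> would give 0 =
  1. Read as a relation with coefficients of \<open>f\<close>, this is independence over the
  rationals of the powers of \<open>t\<close> below \<open>degree p\<close>.\<close>

lemma irreducible_root_powers_independent:
  fixes p f :: "rat poly" and t :: real
  assumes "irreducible p" "poly (map_poly of_rat p) t = 0" "poly (map_poly of_rat f) t = 0"
    and "degree f < degree p"
  shows "f = 0"
proof (rule ccontr)
  assume "f \<noteq> 0"
  then have "\<not> p dvd f"
    using assms(4) by (meson dvd_imp_degree_le not_less)
  then have "coprime p f"
    by (rule prime_elem_imp_coprime[OF field_poly_irreducible_imp_prime[OF assms(1)]])
  then obtain a b where "a * p + b * f = 1"
    by (metis bezout_coefficients_fst_snd coprime_iff_gcd_eq_1)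
  then have "poly (map_poly of_rat (a * p + b * f)) t = (1 :: real)"
    by simp
  then show False
    using assms(2,3) by (simp add: map_poly_of_rat_add map_poly_of_rat_mult)
qed

section \<open>Leading monomials with respect to a real weight\<close>

locale monom_weight =
  fixes L :: "(nat \<Rightarrow>\<^sub>0 nat) \<Rightarrow> real"
  assumes weight_add: "L (a + b) = L a + L b"
begin

text \<open>A relation, because a polynomial whose maximal weight is attained by two monomials has
  no leading monomial. Strictness is what prevents cancellation in products and sums.\<close>

definition lead :: "'a::field mpoly \<Rightarrow> (nat \<Rightarrow>\<^sub>0 nat) \<Rightarrow> bool" where
  "lead p a \<longleftrightarrow> a \<in> Poly_Mapping.keys p \<and> (\<forall>m\<in>Poly_Mapping.keys p. m \<noteq> a \<longrightarrow> L m < L a)"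

lemma lead_nonzero: "lead p a \<Longrightarrow> p \<noteq> 0"
  by (auto simp: lead_def)

lemma lead_const: "c \<noteq> 0 \<Longrightarrow> lead (mpoly_const c) 0"
  by (simp add: lead_def mpoly_const_def)

lemma lead_exists:
  assumes "p \<noteq> 0" "inj_on L (Poly_Mapping.keys p)"
  obtains a where "lead p a"
proof -
  have ne: "Poly_Mapping.keys p \<noteq> {}"
    using assms(1) by simp
  obtain a where a: "a \<in> Poly_Mapping.keys p" "L a = Max (L ` Poly_Mapping.keys p)"
    using Max_in[of "L ` Poly_Mapping.keys p"] ne by fastforce
  have "L m < L a" if "m \<in> Poly_Mapping.keys p" "m \<noteq> a" for m
    using that a assms(2) Max_ge[of "L ` Poly_Mapping.keys p" "L m"]
    by (force simp: inj_on_def less_le)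
  then show ?thesis
    using a(1) that unfolding lead_def by blast
qed

text \<open>The monomial \<open>a + b\<close> arises from the pair \<open>(a, b)\<close> alone, so
  its coefficient is a product of two nonzero field elements.\<close>

lemma lead_mult:
  assumes "lead p a" "lead q b"
  shows "lead (p * q) (a + b)"
proof -
  let ?K = "Poly_Mapping.keys p \<times> Poly_Mapping.keys q"
  let ?f = "\<lambda>x. Poly_Mapping.single (fst x + snd x)
      (Poly_Mapping.lookup p (fst x) * Poly_Mapping.lookup q (snd x))"
  have less: "L (m + m') < L (a + b)"
    if "m \<in> Poly_Mapping.keys p" "m' \<in> Poly_Mapping.keys q" "(m, m') \<noteq> (a, b)" for m m'
  proof -
    have "m \<noteq> a \<Longrightarrow> L m < L a" "m' \<noteq> b \<Longrightarrow> L m' < L b"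
      using assms that by (auto simp: lead_def)
    then show ?thesis
      using that(3) unfolding weight_add by (cases "m = a"; cases "m' = b") auto
  qed
  have "p * q = (\<Sum>m\<in>Poly_Mapping.keys p. \<Sum>m'\<in>Poly_Mapping.keys q.
      Poly_Mapping.single m (Poly_Mapping.lookup p m) * Poly_Mapping.single m' (Poly_Mapping.lookup q m'))"
    by (subst mpoly_sum_singles[of p], subst mpoly_sum_singles[of q]) (rule sum_product)
  also have "\<dots> = (\<Sum>x\<in>?K. ?f x)"
    by (simp add: sum.cartesian_product mult_single case_prod_beta)
  finally have "Poly_Mapping.lookup (p * q) (a + b) = (\<Sum>x\<in>?K. Poly_Mapping.lookup (?f x) (a + b))"
    by (simp add: lookup_sum)
  \<comment> \<open>Any other pair has strictly smaller total weight, so its monomial differs from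
    \<open>a + b\<close>.\<close>
  also have "\<dots> = (\<Sum>x\<in>?K. if x = (a, b) then Poly_Mapping.lookup p a * Poly_Mapping.lookup q b else 0)"
  proof (rule sum.cong)
    fix x assume x: "x \<in> ?K"
    show "Poly_Mapping.lookup (?f x) (a + b) =
      (if x = (a, b) then Poly_Mapping.lookup p a * Poly_Mapping.lookup q b else 0)"
      using less[of "fst x" "snd x"] x by (cases "x = (a, b)") (auto simp: lookup_single when_def mem_Times_iff)
  qed simp
  also have "\<dots> = Poly_Mapping.lookup p a * Poly_Mapping.lookup q b"
    using assms by (simp add: lead_def)
  finally have "a + b \<in> Poly_Mapping.keys (p * q)"
    using assms by (simp add: lead_def in_keys_iff)
  moreover have "L m < L (a + b)" if "m \<in> Poly_Mapping.keys (p * q)" "m \<noteq> a + b" for m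
    using keys_mult[of p q] that less by blast
  ultimately show ?thesis
    by (simp add: lead_def)
qed

lemma lead_add:
  assumes "lead p a" "\<And>m. m \<in> Poly_Mapping.keys q \<Longrightarrow> L m < L a"
  shows "lead (p + q) a"
proof -
  have "a \<notin> Poly_Mapping.keys q"
    using assms(2) by blast
  then have "a \<in> Poly_Mapping.keys (p + q)"
    using assms(1) by (simp add: lead_def in_keys_iff lookup_add)
  then show ?thesis
    using assms keys_add[of p q] unfolding lead_def by blast
qed

lemma lead_weight_le: "lead p a \<Longrightarrow> m \<in> Poly_Mapping.keys p \<Longrightarrow> L m \<le> L a"
  by (auto simp: lead_def less_le)

section \<open>Degrees of rational functions\<close>

text \<open>Partial, as \<open>lead\<close> is: some representing fraction must have leading
  monomials above and below. In particular 0 has no degree, so exhibiting a degree proves that an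
  element is nonzero.\<close>

definition has_degree :: "'a::field ratfun \<Rightarrow> real \<Rightarrow> bool" where
  "has_degree f r \<longleftrightarrow> (\<exists>p q a b. f = Fract p q \<and> lead p a \<and> lead q b \<and> r = L a - L b)"

lemma has_degree_nonzero: "has_degree f r \<Longrightarrow> f \<noteq> 0"
  by (auto simp: has_degree_def Zero_fract_def eq_fract lead_nonzero)

lemma has_degree_const:
  assumes "c \<noteq> 0"
  shows "has_degree (ratfun_const c) 0"
proof -
  have "lead 1 0"
    using lead_const[of 1] by (simp add: mpoly_const.h_one)
  then show ?thesis
    using lead_const[OF assms] unfolding has_degree_def ratfun_const_def by force
qed

lemma has_degree_mult:
  assumes "has_degree f r" "has_degree g s"
  shows "has_degree (f * g) (r + s)"
proof -
  obtain p q a b p' q' a' b' where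
    "f = Fract p q" "lead p a" "lead q b" "r = L a - L b"
    "g = Fract p' q'" "lead p' a'" "lead q' b'" "s = L a' - L b'"
    using assms unfolding has_degree_def by blast
  then have "f * g = Fract (p * p') (q * q')" "lead (p * p') (a + a')" "lead (q * q') (b + b')"
    "r + s = L (a + a') - L (b + b')"
    by (simp_all add: lead_mult weight_add)
  then show ?thesis
    unfolding has_degree_def by blast
qed

lemma has_degree_power:
  assumes "has_degree f r"
  shows "has_degree (f ^ k) (real k * r)"
proof (induction k)
  case 0
  show ?case
    using has_degree_const[of 1] by (simp add: ratfun_const.h_one)
next
  case (Suc k)
  then show ?case
    using has_degree_mult[OF assms Suc] by (simp add: algebra_simps)
qed

lemma has_degree_prod:
  assumes "finite A" "\<And>i. i \<in> A \<Longrightarrow> has_degree (f i) (r i)"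
  shows "has_degree (prod f A) (sum r A)"
  using assms
proof (induction A rule: finite_induct)
  case empty
  show ?case
    using has_degree_const[of 1] by (simp add: ratfun_const.h_one)
qed (auto intro: has_degree_mult)

lemma has_degree_add:
  assumes "has_degree f r" "has_degree g s" "s < r"
  shows "has_degree (f + g) r"
proof -
  obtain p q a b p' q' a' b' where *:
    "f = Fract p q" "lead p a" "lead q b" "r = L a - L b"
    "g = Fract p' q'" "lead p' a'" "lead q' b'" "s = L a' - L b'"
    using assms unfolding has_degree_def by blast
  \<comment> \<open>With denominators cleared, \<open>s < r\<close> says that \<open>a' + b\<close>,
    the leading monomial of \<open>p' * q\<close>, weighs less than \<open>a + b'\<close>.\<close>
  have "L m < L (a + b')" if "m \<in> Poly_Mapping.keys (p' * q)" for m
    using lead_weight_le[OF lead_mult[OF *(6,3)] that] *(4,8) assms(3) by (simp add: weight_add)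
  then have "lead (p * q' + p' * q) (a + b')"
    by (rule lead_add[OF lead_mult[OF *(2,7)]])
  moreover have "lead (q * q') (b + b')"
    using * by (simp add: lead_mult)
  moreover have "f + g = Fract (p * q' + p' * q) (q * q')"
    using * by (simp add: lead_nonzero)
  moreover have "r = L (a + b') - L (b + b')"
    using * by (simp add: weight_add)
  ultimately show ?thesis
    unfolding has_degree_def by blast
qed

text \<open>Induction on the set: the degree of the new summand differs from the maximum so far, so
  \<open>has_degree_add\<close> applies in one of the two orders.\<close>

lemma has_degree_sum:
  assumes "finite A" "A \<noteq> {}" "inj_on r A" "\<And>i. i \<in> A \<Longrightarrow> has_degree (f i) (r i)"
  shows "has_degree (sum f A) (Max (r ` A))"
  using assms
proof (induction A rule: finite_ne_induct)
  case (insert i A)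
  have IH: "has_degree (sum f A) (Max (r ` A))" and i: "has_degree (f i) (r i)"
    using insert by auto
  have "Max (r ` A) \<in> r ` A"
    using insert by (intro Max_in) auto
  moreover have "r i \<notin> r ` A"
    using insert by auto
  ultimately have ne: "Max (r ` A) \<noteq> r i"
    by metis
  show ?case
  proof (cases "Max (r ` A) < r i")
    case True
    then show ?thesis
      using has_degree_add[OF i IH True] True insert.hyps by (simp add: max_absorb1 less_imp_le del: Max_less_iff)
  next
    case False
    then have "r i < Max (r ` A)"
      using ne by simp
    then show ?thesis
      using has_degree_add[OF IH i] insert.hyps by (simp add: max_absorb2 less_imp_le add.commute)
  qed
qed simp

text \<open>The residue field of the degree is the field of constants.\<close>

lemma has_degree_minus_const:
  assumes "q \<noteq> 0" "Fract p q \<notin> range ratfun_const"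
    and inj: "inj_on L (Poly_Mapping.keys p \<union> Poly_Mapping.keys q)"
  obtains c r where "has_degree (Fract p q - ratfun_const c) r" "r \<noteq> 0"
proof -
  have "p \<noteq> 0"
    using assms(2) ratfun_const.h_zero by (metis rangeI fract_collapse(1))
  then obtain a where a: "lead p a"
    using lead_exists inj by (meson inj_on_Un)
  obtain b where b: "lead q b"
    using lead_exists inj assms(1) by (meson inj_on_Un)
  show ?thesis
  proof (cases "a = b")
    \<comment> \<open>Different leading monomials have different weights, so the degree is already
      nonzero and the constant 0 serves.\<close>
    case False
    then have "L a \<noteq> L b"
      using inj a b by (auto simp: inj_on_def lead_def)
    moreover have "has_degree (Fract p q - ratfun_const 0) (L a - L b)"
      unfolding has_degree_def using a b by (auto simp: ratfun_const.h_zero)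
    ultimately show ?thesis
      using that[of 0 "L a - L b"] by simp
  next
    case True
    \<comment> \<open>The quotient of the leading coefficients, chosen so that the monomial
      \<open>a\<close> cancels in \<open>d\<close>.\<close>
    define c where "c = Poly_Mapping.lookup p a / Poly_Mapping.lookup q a"
    define d where "d = p - mpoly_const c * q"
    have qa: "Poly_Mapping.lookup q a \<noteq> 0"
      using b True by (simp add: lead_def in_keys_iff)
    have look: "Poly_Mapping.lookup d m = Poly_Mapping.lookup p m - c * Poly_Mapping.lookup q m" for m
    proof -
      have "mpoly_const c * q = Poly_Mapping.map ((*) c) q"
        unfolding mpoly_const_def by (rule mult_map_scale_conv_mult[symmetric])
      then show ?thesis
        by (simp add: d_def lookup_minus Poly_Mapping.map.rep_eq when_def)
    qed
    have eq: "Fract p q - ratfun_const c = Fract d q"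
      using assms(1) by (simp add: ratfun_const_def d_def)
    \<comment> \<open>Otherwise the fraction would equal the constant \<open>c\<close>.\<close>
    have "Fract d q \<noteq> 0"
      using eq assms(2) by auto
    then have "d \<noteq> 0"
      by (auto simp: fract_collapse)
    \<comment> \<open>No new monomials appear in \<open>d\<close>, so the weight stays injective on
      them. Its leading monomial \<open>e\<close> is not \<open>a\<close>, hence has a weight
      different from that of \<open>b\<close>.\<close>
    have keys: "Poly_Mapping.keys d \<subseteq> Poly_Mapping.keys p \<union> Poly_Mapping.keys q"
      by (auto simp: in_keys_iff look)
    obtain e where e: "lead d e"
      using lead_exists \<open>d \<noteq> 0\<close> inj keys by (meson inj_on_subset)
    have "e \<noteq> a"
      using e qa by (auto simp: lead_def in_keys_iff look c_def)
    moreover have "e \<in> Poly_Mapping.keys p \<union> Poly_Mapping.keys q"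
      using e keys by (auto simp: lead_def)
    ultimately have "L e \<noteq> L b"
      using inj b True by (auto simp: inj_on_def lead_def)
    then show ?thesis
      using that[of c "L e - L b"] e b eq by (auto simp: has_degree_def)
  qed
qed

end

section \<open>The weight scaled by \<open>star\<close>\<close>

definition power_weight :: "nat \<Rightarrow> real \<Rightarrow> (nat \<Rightarrow>\<^sub>0 nat) \<Rightarrow> real" where
  "power_weight n t m = (\<Sum>i<n. real (Poly_Mapping.lookup m i) * t ^ i)"

interpretation power_weight: monom_weight "power_weight n t" for n t
  by unfold_locales (simp add: power_weight_def lookup_add algebra_simps sum.distrib)

text \<open>The variable of index \<open>i\<close> has weight \<open>t ^ i\<close>, and the shift
  multiplies it by \<open>t\<close>. At the wrap-around, \<open>u\<close> copies of the variable 0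
  weigh \<open>u\<close>, which is \<open>t ^ n = t * t ^ (n - 1)\<close>.\<close>

lemma power_weight_star_monom:
  assumes "n > 0" "t ^ n = real u"
  shows "power_weight n t (star_monom n u m) = t * power_weight n t m"
proof -
  obtain k where k: "n = Suc k"
    using assms(1) by (cases n) auto
  have "power_weight n t (star_monom n u m) =
      real (u * Poly_Mapping.lookup m k) + (\<Sum>i<k. real (Poly_Mapping.lookup m i) * t ^ Suc i)"
    unfolding power_weight_def k sum.lessThan_Suc_shift
    using lookup_star_monom_0[of n u m] lookup_star_monom[of _ n u m] k by simp
  also have "\<dots> = t * power_weight n t m"
    using assms(2) by (simp add: power_weight_def k algebra_simps sum_distrib_left)
  finally show ?thesis .
qed

text \<open>Two exponent vectors of equal weight give a rational polynomial \<open>f\<close> of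
  degree below \<open>n\<close> with root \<open>t\<close>, whose coefficients are the differences
  of the exponents; by irreducibility it vanishes.\<close>

lemma inj_on_power_weight:
  assumes "n > 0" "irreducible (monom 1 n - [:of_nat u:] :: rat poly)" "t ^ n = real u"
  shows "inj_on (power_weight n t) {m. Poly_Mapping.keys m \<subseteq> {..<n}}"
proof (rule inj_onI)
  fix m m' :: "nat \<Rightarrow>\<^sub>0 nat"
  assume m: "m \<in> {m. Poly_Mapping.keys m \<subseteq> {..<n}}" "m' \<in> {m. Poly_Mapping.keys m \<subseteq> {..<n}}"
    and eq: "power_weight n t m = power_weight n t m'"
  define p where "p = (monom 1 n - [:of_nat u:] :: rat poly)"
  define c where "c i = (of_nat (Poly_Mapping.lookup m i) - of_nat (Poly_Mapping.lookup m' i) :: rat)" for i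
  define f where "f = (\<Sum>i<n. monom (c i) i)"
  \<comment> \<open>Since \<open>n > 0\<close>, the constant term does not touch the coefficient at
    \<open>n\<close>.\<close>
  have "coeff p n = 1"
    using assms(1) by (simp add: p_def coeff_pCons split: nat.split)
  then have deg: "n \<le> degree p"
    by (intro le_degree) simp
  have "degree f < n"
    unfolding f_def using assms(1)
    by (intro degree_sum_less) (auto intro: le_less_trans[OF degree_monom_le])
  have p0: "poly (map_poly of_rat p) t = 0"
    by (simp add: p_def map_poly_of_rat_diff map_poly_monom poly_monom assms(3) map_poly_pCons)
  have f0: "poly (map_poly of_rat f) t = 0"
    using eq
    by (simp add: f_def map_poly_of_rat_sum map_poly_monom poly_sum poly_monom c_def of_rat_diff
        power_weight_def left_diff_distrib sum_subtractf)
  have "f = 0"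
    by (rule irreducible_root_powers_independent[of p t f])
      (use assms(2) p0 f0 deg \<open>degree f < n\<close> in \<open>auto simp: p_def\<close>)
  show "m = m'"
  proof (rule poly_mapping_eqI)
    fix i
    show "Poly_Mapping.lookup m i = Poly_Mapping.lookup m' i"
    proof (cases "i < n")
      case True
      then have "coeff f i = c i"
        by (simp add: f_def coeff_sum)
      then show ?thesis
        using \<open>f = 0\<close> by (simp add: c_def)
    next
      case False
      then have "i \<notin> Poly_Mapping.keys m" "i \<notin> Poly_Mapping.keys m'"
        using m by auto
      then show ?thesis
        by (simp add: in_keys_iff)
    qed
  qed
qed

section \<open>Action of \<open>star\<close> on leading monomials and degrees\<close>

text \<open>Distinct monomials have distinct images, so coefficients are carried over unchanged, and
  scaling the weights by \<open>t > 0\<close> preserves their order.\<close>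

lemma lead_mpoly_star:
  fixes p :: "'a::field mpoly"
  assumes "n > 0" "u > 0" "t > 0" "t ^ n = real u" "power_weight.lead n t p a"
  shows "power_weight.lead n t (mpoly_star n u p) (star_monom n u a)"
proof -
  have "\<exists>m\<in>Poly_Mapping.keys p. k = star_monom n u m"
    if "k \<in> Poly_Mapping.keys (mpoly_star n u p)" for k
    using that unfolding mpoly_star_eq in_keys_iff lookup_sum
    by (metis (mono_tags, lifting) sum.neutral lookup_single_not_eq)
  moreover have "star_monom n u a \<in> Poly_Mapping.keys (mpoly_star n u p)"
    using assms(5) by (simp add: power_weight.lead_def in_keys_iff lookup_mpoly_star[OF assms(2)])
  ultimately show ?thesis
    using assms(3,5) unfolding power_weight.lead_def
    by (metis mult_less_cancel_left_pos power_weight_star_monom[OF assms(1,4)])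
qed

lemma has_degree_star:
  fixes f :: "'a::field ratfun"
  assumes "n > 0" "u > 0" "t > 0" "t ^ n = real u" "power_weight.has_degree n t f r"
  shows "power_weight.has_degree n t (star n u f) (t * r)"
proof -
  obtain p q a b where *: "f = Fract p q" "power_weight.lead n t p a" "power_weight.lead n t q b"
    "r = power_weight n t a - power_weight n t b"
    using assms(5) unfolding power_weight.has_degree_def by blast
  have "star n u f = Fract (mpoly_star n u p) (mpoly_star n u q)"
    using star_Fract[OF assms(2) power_weight.lead_nonzero[OF *(3)]] *(1) by simp
  moreover have "t * r = power_weight n t (star_monom n u a) - power_weight n t (star_monom n u b)"
    by (simp add: power_weight_star_monom[OF assms(1,4)] *(4) right_diff_distrib)
  ultimately show ?thesis
    unfolding power_weight.has_degree_def
    using lead_mpoly_star[OF assms(1-4)] *(2,3) by blast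
qed

lemma has_degree_star_funpow:
  assumes "n > 0" "u > 0" "t > 0" "t ^ n = real u" "power_weight.has_degree n t f r"
  shows "power_weight.has_degree n t ((star n u ^^ i) f) (t ^ i * r)"
  using assms(5)
  by (induction i) (auto simp: mult.assoc intro: has_degree_star[OF assms(1-4)])

section \<open>Algebraic independence from degrees\<close>

text \<open>The term of \<open>P\<close> with exponent \<open>m\<close> takes degree
  \<open>power_weight n t m * r\<close>. These degrees are pairwise distinct, so the value of a
  nonzero \<open>P\<close> has a degree and cannot be 0.\<close>

lemma alg_independent_has_degree:
  fixes f :: "nat \<Rightarrow> 'a::field ratfun"
  assumes inj: "inj_on (power_weight n t) {m. Poly_Mapping.keys m \<subseteq> {..<n}}"
    and deg: "\<And>i. i < n \<Longrightarrow> power_weight.has_degree n t (f i) (t ^ i * r)" and "r \<noteq> 0"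
  shows "alg_independent n f"
  unfolding alg_independent_def
proof (intro allI impI, rule ccontr)
  fix P :: "'a mpoly"
  assume P: "vars P \<subseteq> {..<n}" "mpoly_eval ratfun_const f P = 0" "P \<noteq> 0"
  let ?K = "Poly_Mapping.keys P"
  have sub: "?K \<subseteq> {m. Poly_Mapping.keys m \<subseteq> {..<n}}"
    using P(1) by (auto simp: vars_def)
  have "power_weight.has_degree n t (ratfun_const (Poly_Mapping.lookup P m) * monom_eval f m)
      (power_weight n t m * r)" if "m \<in> ?K" for m
  proof -
    \<comment> \<open>The product is extended to all indices below \<open>n\<close> to match the sum
      in \<open>power_weight\<close>.\<close>
    have "monom_eval f m = (\<Prod>i<n. f i ^ Poly_Mapping.lookup m i)"
      using that sub by (intro monom_eval_superset) auto
    moreover have "power_weight.has_degree n t (\<Prod>i<n. f i ^ Poly_Mapping.lookup m i)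
        (\<Sum>i<n. real (Poly_Mapping.lookup m i) * (t ^ i * r))"
      by (intro power_weight.has_degree_prod power_weight.has_degree_power deg) auto
    moreover have "(\<Sum>i<n. real (Poly_Mapping.lookup m i) * (t ^ i * r)) = power_weight n t m * r"
      by (simp add: power_weight_def sum_distrib_right mult.assoc)
    moreover have "power_weight.has_degree n t (ratfun_const (Poly_Mapping.lookup P m)) 0"
      using that by (intro power_weight.has_degree_const) (simp add: in_keys_iff)
    ultimately show ?thesis
      using power_weight.has_degree_mult by (metis add_0)
  qed
  moreover have "inj_on (\<lambda>m. power_weight n t m * r) ?K"
    using inj_on_subset[OF inj sub] \<open>r \<noteq> 0\<close> by (auto simp: inj_on_def)
  ultimately have "power_weight.has_degree n t (mpoly_eval ratfun_const f P)
      (Max ((\<lambda>m. power_weight n t m * r) ` ?K))"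
    unfolding mpoly_eval_def using P(3) by (intro power_weight.has_degree_sum) auto
  then show False
    using P(2) power_weight.has_degree_nonzero by blast
qed

section \<open>Translation by constants\<close>

context coeff_hom
begin

lemma eval_power: "mpoly_eval h x (p ^ k) = mpoly_eval h x p ^ k"
  by (induction k) (auto simp: eval_mult)

lemma eval_prod: "mpoly_eval h x (prod f A) = (\<Prod>a\<in>A. mpoly_eval h x (f a))"
  by (induction A rule: infinite_finite_induct) (auto simp: eval_mult)

text \<open>Composition of substitutions, used to translate the variables by a constant and back
  again.\<close>

lemma eval_eval:
  fixes s :: "nat \<Rightarrow> 'a mpoly"
  shows "mpoly_eval h x (mpoly_eval mpoly_const s p) = mpoly_eval h (\<lambda>i. mpoly_eval h x (s i)) p"
proof -
  have "mpoly_eval h x (monom_eval s m) = monom_eval (\<lambda>i. mpoly_eval h x (s i)) m" for m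
    by (simp add: monom_eval_def eval_prod eval_power)
  then show ?thesis
    by (simp add: mpoly_eval_def[of mpoly_const] mpoly_eval_def[of h "\<lambda>i. mpoly_eval h x (s i)"]
        eval_sum eval_mult eval_const)
qed

end

lemma mpoly_eval_var: "mpoly_eval mpoly_const mpoly_var p = (p :: 'a::field mpoly)"
proof -
  have "monom_eval mpoly_var m = Poly_Mapping.single m (1::'a)" for m
  proof -
    have "monom_eval mpoly_var m = Poly_Mapping.single
        (\<Sum>i\<in>Poly_Mapping.keys m. of_nat (Poly_Mapping.lookup m i) * Poly_Mapping.single i 1) (1::'a)"
      by (simp add: monom_eval_def mpoly_var_def single_power prod_single)
    also have "(\<Sum>i\<in>Poly_Mapping.keys m. of_nat (Poly_Mapping.lookup m i) * Poly_Mapping.single i 1) = m"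
      by (rule poly_mapping_eqI)
        (auto simp: lookup_sum lookup_of_nat_mult lookup_single when_def in_keys_iff
          if_distrib[where f = "(*) _"] cong: if_cong)
    finally show ?thesis .
  qed
  then show ?thesis
    using mpoly_sum_singles[of p] by (simp add: mpoly_eval_def mpoly_const_def mult_single)
qed

lemma vars_mult: "vars (p * q) \<subseteq> vars p \<union> vars (q :: 'a::field mpoly)"
proof
  fix i assume "i \<in> vars (p * q)"
  then obtain k where "k \<in> Poly_Mapping.keys (p * q)" "i \<in> Poly_Mapping.keys k"
    by (auto simp: vars_def)
  then obtain a b where "a \<in> Poly_Mapping.keys p" "b \<in> Poly_Mapping.keys q"
    "i \<in> Poly_Mapping.keys (a + b)"
    using keys_mult[of p q] by blast
  then show "i \<in> vars p \<union> vars q"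
    using keys_add[of a b] by (auto simp: vars_def)
qed

lemma vars_one: "vars (1 :: 'a::field mpoly) = {}"
  by (auto simp: vars_def)

lemma vars_power: "vars (p ^ k) \<subseteq> vars (p :: 'a::field mpoly)"
proof (induction k)
  case (Suc k)
  then show ?case
    using vars_mult[of p "p ^ k"] by auto
qed (simp add: vars_one)

lemma vars_prod: "vars (prod f A) \<subseteq> (\<Union>a\<in>A. vars (f a :: 'a::field mpoly))"
proof (induction A rule: infinite_finite_induct)
  case (insert a A)
  then show ?case
    using vars_mult[of "f a" "prod f A"] by auto
qed (simp_all add: vars_one)

lemma vars_mpoly_eval:
  fixes s :: "nat \<Rightarrow> 'a::field mpoly"
  shows "vars (mpoly_eval mpoly_const s p) \<subseteq> (\<Union>i\<in>vars p. vars (s i))"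
proof -
  have "vars (mpoly_const (Poly_Mapping.lookup p m) * monom_eval s m) \<subseteq> (\<Union>i\<in>vars p. vars (s i))"
    if "m \<in> Poly_Mapping.keys p" for m
  proof -
    have "vars (monom_eval s m) \<subseteq> (\<Union>i\<in>Poly_Mapping.keys m. vars (s i))"
      unfolding monom_eval_def by (rule order_trans[OF vars_prod]) (intro UN_mono order_refl vars_power)
    moreover have "vars (mpoly_const (Poly_Mapping.lookup p m)) = {}"
      by (auto simp: vars_def mpoly_const_def)
    moreover have "Poly_Mapping.keys m \<subseteq> vars p"
      using that by (auto simp: vars_def)
    ultimately show ?thesis
      using vars_mult[of "mpoly_const (Poly_Mapping.lookup p m)" "monom_eval s m"] by blast
  qed
  then show ?thesis
    unfolding mpoly_eval_def by (intro order_trans[OF vars_sum] UN_least)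
qed

text \<open>Substituting \<open>x_i + c\<close> for \<open>x_i\<close> turns a relation
  \<open>P\<close> among the \<open>f i\<close> into a relation \<open>Q\<close> among the
  \<open>f i - c\<close>. The opposite translation recovers \<open>P\<close> from \<open>Q\<close>,
  so \<open>Q = 0\<close> forces \<open>P = 0\<close>.\<close>

lemma alg_independent_minus_const:
  fixes f :: "nat \<Rightarrow> 'a::field ratfun"
  assumes "alg_independent n (\<lambda>i. f i - ratfun_const c)"
  shows "alg_independent n f"
  unfolding alg_independent_def
proof (intro allI impI)
  fix P :: "'a mpoly"
  assume P: "vars P \<subseteq> {..<n}" "mpoly_eval ratfun_const f P = 0"
  define Q where "Q = mpoly_eval mpoly_const (\<lambda>i. mpoly_var i + mpoly_const c) P"
  have "vars (mpoly_var i :: 'a mpoly) \<subseteq> {i}" "vars (mpoly_const c) = {}" for i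
    by (auto simp: vars_def mpoly_var_def mpoly_const_def)
  then have "vars (mpoly_var i + mpoly_const c) \<subseteq> {i}" for i
    using vars_add[of "mpoly_var i" "mpoly_const c"] by blast
  then have "vars Q \<subseteq> {..<n}"
    unfolding Q_def using vars_mpoly_eval P(1) by blast
  moreover have "mpoly_eval ratfun_const (\<lambda>i. f i - ratfun_const c) Q = 0"
    unfolding Q_def using P(2)
    by (simp add: ratfun_const.eval_eval ratfun_const.eval_add ratfun_const.eval_var ratfun_const.eval_const)
  ultimately have "Q = 0"
    using assms unfolding alg_independent_def by blast
  moreover have "mpoly_eval mpoly_const (\<lambda>i. mpoly_var i - mpoly_const c) Q = P"
    unfolding Q_def
    by (simp add: mpoly_const.eval_eval mpoly_const.eval_add mpoly_const.eval_var
        mpoly_const.eval_const mpoly_eval_var)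
  ultimately show "P = 0"
    by simp
qed

lemma star_funpow_minus_const:
  assumes "u > 0"
  shows "(star n u ^^ i) (g - ratfun_const c) = (star n u ^^ i) g - ratfun_const c"
proof (induction i)
  case (Suc i)
  \<comment> \<open>Adding the constant back reduces subtraction to the additivity of
    \<open>star\<close>, which fixes constants.\<close>
  have "star n u (f - ratfun_const c) + ratfun_const c = star n u f" for f
    using star_add[OF assms, of n "f - ratfun_const c" "ratfun_const c"]
    by (simp add: star_const[OF assms])
  then show ?case
    by (simp add: Suc eq_diff_eq)
qed simp

theorem theorem2p3:
  fixes g :: "'a::field ratfun" and n u :: nat
  assumes "n > 0" and "u > 0"
    and "irreducible (monom 1 n - [:of_nat u:] :: rat poly)"
    and "g \<in> ratfuns n" and "g \<notin> range ratfun_const"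
  shows "alg_independent n (\<lambda>i. (star n u ^^ i) g)"
proof -
  \<comment> \<open>The positive real root of \<open>x^n - u\<close>, by which \<open>star\<close>
    scales every degree.\<close>
  define t where "t = root n (real u)"
  have t: "t > 0" "t ^ n = real u"
    using assms(1,2) by (simp_all add: t_def)
  have inj: "inj_on (power_weight n t) {m. Poly_Mapping.keys m \<subseteq> {..<n}}"
    using inj_on_power_weight[OF assms(1,3) t(2)] .
  obtain p q where pq: "g = Fract p q" "q \<noteq> 0" "vars p \<subseteq> {..<n}" "vars q \<subseteq> {..<n}"
    using assms(4) unfolding ratfuns_def by blast
  have "inj_on (power_weight n t) (Poly_Mapping.keys p \<union> Poly_Mapping.keys q)"
    by (rule inj_on_subset[OF inj]) (use pq(3,4) in \<open>auto simp: vars_def\<close>)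
  then obtain c r where "power_weight.has_degree n t (g - ratfun_const c) r" "r \<noteq> 0"
    using power_weight.has_degree_minus_const pq(1,2) assms(5) by metis
  \<comment> \<open>The iterates of \<open>g - c\<close> have degrees \<open>t ^ i * r\<close> with
    \<open>r\<close> nonzero.\<close>
  then have "alg_independent n (\<lambda>i. (star n u ^^ i) (g - ratfun_const c))"
    by (intro alg_independent_has_degree[OF inj] has_degree_star_funpow[OF assms(1,2) t])
  then show ?thesis
    by (simp add: star_funpow_minus_const[OF assms(2)] alg_independent_minus_const)
qed

end
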